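(* Let $L\subseteq\Sigma^*$ be a regular language. Then $$\mathfrak{dfa}(L):=(L,(\mathsf{LQ}(L),\cup,\emptyset),\lambda X.\,a^{-1}X,\{X\in\mathsf{LQ}(L):\varepsilon\in X\})$$ is the state-minimal $\mathsf{JSL}$-dfa accepting $L$; that is, it is a $\mathsf{JSL}$-dfa accepting $L$, and every $\mathsf{JSL}$-dfa accepting $L$ has at least $|\mathsf{LQ}(L)|$ states.
   Context: Fix an alphabet $\Sigma$. For $U\subseteq\Sigma^*$ the left quotient is $U^{-1}L=\{w\in\Sigma^*:\exists u\in U.\ uw\in L\}$, and $a^{-1}X:=\{a\}^{-1}X$. $\mathsf{LQ}(L)=\{U^{-1}L:U\subseteq\Sigma^*\}$, a finite set for regular $L$. A join-semilattice has all finite joins, including a bottom; morphisms preserve all finite joins. A $\mathsf{JSL}$-dfa is a tuple $(s_0,\mathbb S,\delta_a,F)$ where $\mathbb S$ is a finite join-semilattice with underlying set $S$ (the states), $s_0\in S$, $\delta_a:\mathbb S\to\mathbb S$ is a join-semilattice morphism for each $a\in\Sigma$, and $F=\{s\in S:s\nleq_{\mathbb S}t\}$ for some $t\in S$. It accepts the language accepted by its underlying deterministic automaton with initial state $s_0$, transitions $\delta_a$ and final states $F$. *)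

theory Defs
  imports "HOL-Algebra.Lattice"
begin

text \<open>The alphabet is an explicit set \<open>\<Sigma>\<close> of letters (possibly empty); \<open>\<Sigma>\<^sup>*\<close> is \<^term>\<open>lists \<Sigma>\<close>.\<close>

definition left_quotient :: "'a set \<Rightarrow> 'a list set \<Rightarrow> 'a list set \<Rightarrow> 'a list set" where
  "left_quotient \<Sigma> U L = {w \<in> lists \<Sigma>. \<exists>u\<in>U. u @ w \<in> L}"

definition LQ :: "'a set \<Rightarrow> 'a list set \<Rightarrow> 'a list set set" where
  "LQ \<Sigma> L = {left_quotient \<Sigma> U L | U. U \<subseteq> lists \<Sigma>}"

record ('a, 's) automaton =
  init :: 's
  states :: "'s set"
  trans :: "'a \<Rightarrow> 's \<Rightarrow> 's"
  final :: "'s set"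

definition is_dfa :: "'a set \<Rightarrow> ('a, 's) automaton \<Rightarrow> bool" where
  "is_dfa \<Sigma> M \<longleftrightarrow>
     finite (states M) \<and> init M \<in> states M \<and> final M \<subseteq> states M \<and>
     (\<forall>a\<in>\<Sigma>. trans M a \<in> states M \<rightarrow> states M)"

definition language :: "'a set \<Rightarrow> ('a, 's) automaton \<Rightarrow> 'a list set" where
  "language \<Sigma> M = {w \<in> lists \<Sigma>. fold (trans M) w (init M) \<in> final M}"

text \<open>Natural numbers as states are no restriction: every finite state set can be renamed.\<close>

definition regular :: "'a set \<Rightarrow> 'a list set \<Rightarrow> bool" where
  "regular \<Sigma> L \<longleftrightarrow> (\<exists>M :: ('a, nat) automaton. is_dfa \<Sigma> M \<and> language \<Sigma> M = L)"

text \<open>Binary joins and a bottom element, that is, all finite joins.\<close>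

locale join_semilattice = upper_semilattice + weak_partial_order_bottom

text \<open>The case \<open>A = {}\<close> is preservation of the bottom element.\<close>

definition jsl_morphism ::
  "('s, 'm) gorder_scheme \<Rightarrow> ('t, 'n) gorder_scheme \<Rightarrow> ('s \<Rightarrow> 't) \<Rightarrow> bool" where
  "jsl_morphism S T f \<longleftrightarrow>
     f \<in> carrier S \<rightarrow> carrier T \<and>
     (\<forall>A \<subseteq> carrier S. finite A \<longrightarrow> f (\<Squnion>\<^bsub>S\<^esub> A) = \<Squnion>\<^bsub>T\<^esub> (f ` A))"

record ('a, 's) jsl_automaton =
  jinit :: 's
  jsl :: "'s gorder"
  jtrans :: "'a \<Rightarrow> 's \<Rightarrow> 's"
  jfinal :: "'s set"

definition is_jsl_dfa :: "'a set \<Rightarrow> ('a, 's) jsl_automaton \<Rightarrow> bool" where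
  "is_jsl_dfa \<Sigma> M \<longleftrightarrow>
     join_semilattice (jsl M) \<and> finite (carrier (jsl M)) \<and>
     jinit M \<in> carrier (jsl M) \<and>
     (\<forall>a\<in>\<Sigma>. jsl_morphism (jsl M) (jsl M) (jtrans M a)) \<and>
     (\<exists>t \<in> carrier (jsl M). jfinal M = {s \<in> carrier (jsl M). \<not> s \<sqsubseteq>\<^bsub>jsl M\<^esub> t})"

definition underlying :: "('a, 's) jsl_automaton \<Rightarrow> ('a, 's) automaton" where
  "underlying M =
     \<lparr>init = jinit M, states = carrier (jsl M), trans = jtrans M, final = jfinal M\<rparr>"

definition accepts :: "'a set \<Rightarrow> ('a, 's) jsl_automaton \<Rightarrow> 'a list set \<Rightarrow> bool" where
  "accepts \<Sigma> M L \<longleftrightarrow> language \<Sigma> (underlying M) = L"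

definition LQ_jsl :: "'a set \<Rightarrow> 'a list set \<Rightarrow> 'a list set gorder" where
  "LQ_jsl \<Sigma> L = \<lparr>carrier = LQ \<Sigma> L, eq = (=), le = (\<subseteq>)\<rparr>"

definition canonical_dfa :: "'a set \<Rightarrow> 'a list set \<Rightarrow> ('a, 'a list set) jsl_automaton" where
  "canonical_dfa \<Sigma> L =
     \<lparr>jinit = L, jsl = LQ_jsl \<Sigma> L,
      jtrans = (\<lambda>a X. left_quotient \<Sigma> {[a]} X),
      jfinal = {X \<in> LQ \<Sigma> L. [] \<in> X}\<rparr>"

end

theory Submission
  imports Defs
begin

text \<open>
  For a state \<open>s\<close> of an automaton let \<open>lang s\<close> be the language accepted from \<open>s\<close>. Then
  \<open>U\<^sup>-\<^sup>1L\<close> is the union of \<open>lang s\<close> over the states \<open>s\<close> reached by the words of \<open>U\<close>; since a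
  dfa has finitely many sets of states, \<open>LQ(L)\<close> is finite for regular \<open>L\<close>. In a JSL-dfa the
  transitions preserve finite joins and the complement \<open>{s. s \<le> t}\<close> of the final states is
  closed under them, so \<open>lang\<close> maps joins to unions. Hence every \<open>U\<^sup>-\<^sup>1L\<close> is \<open>lang s\<close> of a
  single state \<open>s\<close>, the join of the states reached by \<open>U\<close>, and \<open>lang\<close> maps the states onto a
  superset of \<open>LQ(L)\<close>.
\<close>

section \<open>Languages of states and finiteness of the set of quotients\<close>

definition state_language :: "'a set \<Rightarrow> ('a, 's) automaton \<Rightarrow> 's \<Rightarrow> 'a list set" where
  "state_language \<Sigma> M q = language \<Sigma> (M\<lparr>init := q\<rparr>)"

lemma mem_state_language_iff:
  "w \<in> state_language \<Sigma> M q \<longleftrightarrow> w \<in> lists \<Sigma> \<and> fold (trans M) w q \<in> final M"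
  by (simp add: state_language_def language_def)

text \<open>Reading \<open>u @ w\<close> means reading \<open>w\<close> from the state reached by
  \<open>u\<close>, so the quotient depends on \<open>U\<close> only through the reached states.
  Serves both for finiteness and for the lower bound.\<close>

lemma left_quotient_language:
  assumes "U \<subseteq> lists \<Sigma>"
  shows "left_quotient \<Sigma> U (language \<Sigma> M) =
    (\<Union>q \<in> (\<lambda>u. fold (trans M) u (init M)) ` U. state_language \<Sigma> M q)"
proof -
  have "u @ w \<in> language \<Sigma> M \<longleftrightarrow>
      w \<in> state_language \<Sigma> M (fold (trans M) u (init M))" if "u \<in> U" "w \<in> lists \<Sigma>" for u w
    using that assms[THEN subsetD, of u] by (simp add: language_def mem_state_language_iff)
  then show ?thesis
    by (fastforce simp: left_quotient_def mem_state_language_iff)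
qed

lemma fold_trans_closed:
  assumes "is_dfa \<Sigma> M" "w \<in> lists \<Sigma>" "q \<in> states M"
  shows "fold (trans M) w q \<in> states M"
  using assms(2,3) assms(1)[unfolded is_dfa_def]
  by (induction w arbitrary: q) (auto simp: Pi_iff)

lemma reached_subset_states:
  assumes "is_dfa \<Sigma> M" "U \<subseteq> lists \<Sigma>"
  shows "(\<lambda>u. fold (trans M) u (init M)) ` U \<subseteq> states M"
proof -
  have "init M \<in> states M"
    using assms(1) by (simp add: is_dfa_def)
  then show ?thesis
    using fold_trans_closed[OF assms(1)] assms(2) by blast
qed

lemma finite_LQ:
  assumes "regular \<Sigma> L"
  shows "finite (LQ \<Sigma> L)"
proof -
  obtain M :: "('a, nat) automaton" where M: "is_dfa \<Sigma> M" "language \<Sigma> M = L"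
    using assms by (auto simp: regular_def)
  have "LQ \<Sigma> L \<subseteq> (\<lambda>Q. \<Union>q\<in>Q. state_language \<Sigma> M q) ` Pow (states M)"
  proof
    fix X assume "X \<in> LQ \<Sigma> L"
    then obtain U where U: "U \<subseteq> lists \<Sigma>" "X = left_quotient \<Sigma> U L"
      by (auto simp: LQ_def)
    show "X \<in> (\<lambda>Q. \<Union>q\<in>Q. state_language \<Sigma> M q) ` Pow (states M)"
      unfolding U(2) M(2)[symmetric] left_quotient_language[OF U(1)]
      using reached_subset_states[OF M(1) U(1)] by blast
  qed
  moreover have "finite (Pow (states M))"
    using M(1) by (simp add: is_dfa_def)
  ultimately show ?thesis
    by (rule finite_surj[rotated])
qed

section \<open>The join-semilattice of left quotients\<close>

lemma left_quotient_Union: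
  "left_quotient \<Sigma> (\<Union>\<U>) L = (\<Union>U\<in>\<U>. left_quotient \<Sigma> U L)"
  by (auto simp: left_quotient_def)

lemma left_quotient_mem_LQ:
  assumes "U \<subseteq> lists \<Sigma>"
  shows "left_quotient \<Sigma> U L \<in> LQ \<Sigma> L"
  using assms unfolding LQ_def by blast

text \<open>Quotients commute with unions in the quotienting set, so choosing a representing set for
  each member and uniting the choices represents the union. The empty family gives the empty
  language.\<close>

lemma Union_mem_LQ:
  assumes "\<X> \<subseteq> LQ \<Sigma> L"
  shows "\<Union>\<X> \<in> LQ \<Sigma> L"
proof -
  have "\<forall>X\<in>\<X>. \<exists>U. U \<subseteq> lists \<Sigma> \<and> X = left_quotient \<Sigma> U L"
    using assms by (auto simp: LQ_def)
  then obtain f where f: "\<And>X. X \<in> \<X> \<Longrightarrow> f X \<subseteq> lists \<Sigma> \<and> X = left_quotient \<Sigma> (f X) L"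
    by metis
  have "left_quotient \<Sigma> (\<Union>(f ` \<X>)) L = (\<Union>X\<in>\<X>. left_quotient \<Sigma> (f X) L)"
    by (auto simp: left_quotient_Union)
  also have "\<dots> = (\<Union>X\<in>\<X>. X)"
    by (rule SUP_cong) (use f in auto)
  finally have "\<Union>\<X> = left_quotient \<Sigma> (\<Union>(f ` \<X>)) L"
    by simp
  moreover have "\<Union>(f ` \<X>) \<subseteq> lists \<Sigma>"
    using f by blast
  ultimately show ?thesis
    by (simp only: left_quotient_mem_LQ)
qed

lemma language_mem_LQ:
  assumes "L \<subseteq> lists \<Sigma>"
  shows "L \<in> LQ \<Sigma> L"
proof -
  have "left_quotient \<Sigma> {[]} L = L"
    using assms by (auto simp: left_quotient_def simp del: in_lists_conv_set)
  then show ?thesis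
    using left_quotient_mem_LQ[of "{[]}" \<Sigma> L] by simp
qed

text \<open>Quotients compose: \<open>a^{-1}(U^{-1}L) = (Ua)^{-1}L\<close>.\<close>

lemma left_quotient_letter_mem_LQ:
  assumes "a \<in> \<Sigma>" "X \<in> LQ \<Sigma> L"
  shows "left_quotient \<Sigma> {[a]} X \<in> LQ \<Sigma> L"
proof -
  obtain U where U: "U \<subseteq> lists \<Sigma>" "X = left_quotient \<Sigma> U L"
    using assms(2) by (auto simp: LQ_def)
  have "left_quotient \<Sigma> {[a]} X = left_quotient \<Sigma> ((\<lambda>u. u @ [a]) ` U) L"
    using assms(1) by (auto simp: left_quotient_def U(2))
  moreover have "(\<lambda>u. u @ [a]) ` U \<subseteq> lists \<Sigma>"
    using U(1) assms(1) by fastforce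
  ultimately show ?thesis
    by (simp only: left_quotient_mem_LQ)
qed

lemma partial_order_LQ_jsl: "partial_order (LQ_jsl \<Sigma> L)"
  by unfold_locales (auto simp: LQ_jsl_def)

lemma least_Upper_LQ_jsl:
  assumes "\<X> \<subseteq> LQ \<Sigma> L"
  shows "least (LQ_jsl \<Sigma> L) (\<Union>\<X>) (Upper (LQ_jsl \<Sigma> L) \<X>)"
  using assms Union_mem_LQ[OF assms]
  by (intro least_UpperI) (auto simp: LQ_jsl_def Upper_def)

text \<open>\<open>sup\<close> is a Hilbert choice among least upper bounds; antisymmetry makes the
  union the only candidate.\<close>

lemma sup_LQ_jsl:
  assumes "\<X> \<subseteq> LQ \<Sigma> L"
  shows "\<Squnion>\<^bsub>LQ_jsl \<Sigma> L\<^esub> \<X> = \<Union>\<X>"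
  unfolding sup_def
  by (intro some_equality least_Upper_LQ_jsl[OF assms])
    (rule partial_order.least_unique[OF partial_order_LQ_jsl _ least_Upper_LQ_jsl[OF assms]])

lemma join_semilattice_LQ_jsl: "join_semilattice (LQ_jsl \<Sigma> L)"
proof -
  interpret partial_order "LQ_jsl \<Sigma> L"
    by (rule partial_order_LQ_jsl)
  show ?thesis
  proof unfold_locales
    show "\<exists>s. least (LQ_jsl \<Sigma> L) s (Upper (LQ_jsl \<Sigma> L) {X, Y})"
      if "X \<in> carrier (LQ_jsl \<Sigma> L)" "Y \<in> carrier (LQ_jsl \<Sigma> L)" for X Y
      using that least_Upper_LQ_jsl[of "{X, Y}" \<Sigma> L] by (auto simp: LQ_jsl_def)
    \<comment> \<open>Every element bounds the empty family, so its least upper bound is the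
      bottom.\<close>
    show "\<exists>X. least (LQ_jsl \<Sigma> L) X (carrier (LQ_jsl \<Sigma> L))"
      using least_Upper_LQ_jsl[of "{}" \<Sigma> L] by auto
  qed
qed

lemma bottom_LQ_jsl: "\<bottom>\<^bsub>LQ_jsl \<Sigma> L\<^esub> = {}"
  using sup_LQ_jsl[of "{}" \<Sigma> L] by (simp add: bottom_def sup_def)

lemma jsl_morphism_left_quotient_letter:
  assumes "a \<in> \<Sigma>"
  shows "jsl_morphism (LQ_jsl \<Sigma> L) (LQ_jsl \<Sigma> L) (left_quotient \<Sigma> {[a]})"
  unfolding jsl_morphism_def
proof (intro conjI allI impI)
  show "left_quotient \<Sigma> {[a]} \<in> carrier (LQ_jsl \<Sigma> L) \<rightarrow> carrier (LQ_jsl \<Sigma> L)"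
    using left_quotient_letter_mem_LQ[OF assms] by (auto simp: LQ_jsl_def)
next
  fix \<X> assume "\<X> \<subseteq> carrier (LQ_jsl \<Sigma> L)"
  then have X: "\<X> \<subseteq> LQ \<Sigma> L"
    by (simp add: LQ_jsl_def)
  \<comment> \<open>The image must consist of quotients for its join to be a union as well; then
    quotients distribute over unions.\<close>
  moreover have "left_quotient \<Sigma> {[a]} ` \<X> \<subseteq> LQ \<Sigma> L"
    using X left_quotient_letter_mem_LQ[OF assms] by auto
  ultimately show "left_quotient \<Sigma> {[a]} (\<Squnion>\<^bsub>LQ_jsl \<Sigma> L\<^esub> \<X>) =
      \<Squnion>\<^bsub>LQ_jsl \<Sigma> L\<^esub> (left_quotient \<Sigma> {[a]} ` \<X>)"
    by (auto simp: sup_LQ_jsl left_quotient_def)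
qed

section \<open>The canonical automaton\<close>

lemma is_jsl_dfa_canonical_dfa:
  assumes "L \<subseteq> lists \<Sigma>" "regular \<Sigma> L"
  shows "is_jsl_dfa \<Sigma> (canonical_dfa \<Sigma> L)"
proof -
  \<comment> \<open>\<open>T\<close> is the largest quotient without the empty word, hence the
    threshold that cuts out the final states.\<close>
  define T where "T = \<Union>{X \<in> LQ \<Sigma> L. [] \<notin> X}"
  have "T \<in> LQ \<Sigma> L"
    unfolding T_def by (rule Union_mem_LQ) auto
  moreover have "{X \<in> LQ \<Sigma> L. [] \<in> X} = {X \<in> LQ \<Sigma> L. \<not> X \<subseteq> T}"
    by (auto simp: T_def)
  ultimately show ?thesis
    using join_semilattice_LQ_jsl[of \<Sigma> L] finite_LQ[OF assms(2)] language_mem_LQ[OF assms(1)]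
      jsl_morphism_left_quotient_letter[of _ \<Sigma> L]
    by (auto simp: is_jsl_dfa_def canonical_dfa_def LQ_jsl_def)
qed

text \<open>Iterates \<open>(aw)^{-1}X = w^{-1}(a^{-1}X)\<close>. For the empty word,
  \<open>X \<subseteq> lists \<Sigma>\<close> ensures that the quotient is all of
  \<open>X\<close>.\<close>

lemma fold_left_quotient_letter:
  assumes "X \<subseteq> lists \<Sigma>" "w \<in> lists \<Sigma>"
  shows "fold (\<lambda>a. left_quotient \<Sigma> {[a]}) w X = left_quotient \<Sigma> {w} X"
  using assms(2,1)
proof (induction w arbitrary: X)
  case Nil
  then show ?case by (auto simp: left_quotient_def)
next
  case (Cons a w)
  have "left_quotient \<Sigma> {[a]} X \<subseteq> lists \<Sigma>"
    by (auto simp: left_quotient_def)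
  then show ?case
    using Cons by (auto simp: left_quotient_def)
qed

text \<open>After \<open>w\<close> the state is \<open>w^{-1}L\<close>, which contains the empty
  word iff \<open>w \<in> L\<close>.\<close>

lemma accepts_canonical_dfa:
  assumes "L \<subseteq> lists \<Sigma>"
  shows "accepts \<Sigma> (canonical_dfa \<Sigma> L) L"
proof -
  have "fold (\<lambda>a. left_quotient \<Sigma> {[a]}) w L \<in> {X \<in> LQ \<Sigma> L. [] \<in> X} \<longleftrightarrow> w \<in> L"
    if w: "w \<in> lists \<Sigma>" for w
    using left_quotient_mem_LQ[of "{w}" \<Sigma> L] w
    unfolding fold_left_quotient_letter[OF assms w] by (simp add: left_quotient_def)
  then show ?thesis
    using assms
    by (auto simp: accepts_def language_def underlying_def canonical_dfa_def
        simp del: in_lists_conv_set)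
qed

section \<open>Joins of states and the lower bound\<close>

lemma (in join_semilattice) finite_sup_least_Upper:
  assumes "finite A" "A \<subseteq> carrier L"
  shows "least L (\<Squnion>A) (Upper L A)"
proof (cases "A = {}")
  case True
  then show ?thesis
    using bottom_least by (simp add: sup_def bottom_def)
next
  case False
  then show ?thesis
    using assms finite_sup_least by blast
qed

text \<open>Applied to the threshold \<open>t\<close> of a JSL-dfa: a finite join of states is
  non-final iff all its members are.\<close>

lemma (in join_semilattice) sup_le_iff:
  assumes "finite A" "A \<subseteq> carrier L" "t \<in> carrier L"
  shows "\<Squnion>A \<sqsubseteq> t \<longleftrightarrow> (\<forall>s\<in>A. s \<sqsubseteq> t)"
proof -
  note least = finite_sup_least_Upper[OF assms(1,2)]
  have closed: "\<Squnion>A \<in> carrier L"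
    using least by (rule least_closed)
  show ?thesis
  proof
    assume le: "\<Squnion>A \<sqsubseteq> t"
    show "\<forall>s\<in>A. s \<sqsubseteq> t"
    proof
      fix s assume s: "s \<in> A"
      show "s \<sqsubseteq> t"
        using least_Upper_above[OF least s assms(2)] le
        by (rule le_trans) (use s assms closed in auto)
    qed
  next
    assume "\<forall>s\<in>A. s \<sqsubseteq> t"
    then show "\<Squnion>A \<sqsubseteq> t"
      using assms(3) by (intro least_le[OF least] Upper_memI) auto
  qed
qed

lemma is_dfa_underlying:
  assumes "is_jsl_dfa \<Sigma> M"
  shows "is_dfa \<Sigma> (underlying M)"
  using assms by (auto simp: is_jsl_dfa_def is_dfa_def underlying_def jsl_morphism_def)

text \<open>Join-preserving maps compose. The induction needs arbitrary \<open>A\<close>, since a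
  letter replaces \<open>A\<close> by its image.\<close>

lemma fold_jtrans_sup:
  assumes "is_jsl_dfa \<Sigma> M" "w \<in> lists \<Sigma>" "finite A" "A \<subseteq> carrier (jsl M)"
  shows "fold (jtrans M) w (\<Squnion>\<^bsub>jsl M\<^esub> A) = \<Squnion>\<^bsub>jsl M\<^esub> (fold (jtrans M) w ` A)"
  using assms(2-)
proof (induction w arbitrary: A)
  case Nil
  then show ?case by simp
next
  case (Cons a w)
  have morph: "jsl_morphism (jsl M) (jsl M) (jtrans M a)"
    using assms(1) Cons.hyps by (auto simp: is_jsl_dfa_def)
  then have "jtrans M a ` A \<subseteq> carrier (jsl M)"
    using Cons.prems by (auto simp: jsl_morphism_def Pi_iff)
  then have "fold (jtrans M) w (\<Squnion>\<^bsub>jsl M\<^esub> (jtrans M a ` A)) =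
      \<Squnion>\<^bsub>jsl M\<^esub> (fold (jtrans M) w ` jtrans M a ` A)"
    using Cons by blast
  moreover have "jtrans M a (\<Squnion>\<^bsub>jsl M\<^esub> A) = \<Squnion>\<^bsub>jsl M\<^esub> (jtrans M a ` A)"
    using morph Cons.prems by (auto simp: jsl_morphism_def)
  ultimately show ?case
    by (simp add: image_image)
qed

lemma state_language_sup:
  assumes "is_jsl_dfa \<Sigma> M" "A \<subseteq> carrier (jsl M)"
  shows "state_language \<Sigma> (underlying M) (\<Squnion>\<^bsub>jsl M\<^esub> A) =
    (\<Union>s\<in>A. state_language \<Sigma> (underlying M) s)"
proof -
  interpret join_semilattice "jsl M"
    using assms(1) by (simp add: is_jsl_dfa_def)
  obtain t where t: "t \<in> carrier (jsl M)"
    and final: "jfinal M = {s \<in> carrier (jsl M). \<not> s \<sqsubseteq>\<^bsub>jsl M\<^esub> t}"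
    using assms(1) by (auto simp: is_jsl_dfa_def)
  have fin: "finite A"
    using assms finite_subset by (auto simp: is_jsl_dfa_def)
  have "fold (jtrans M) w (\<Squnion>\<^bsub>jsl M\<^esub> A) \<in> jfinal M \<longleftrightarrow>
      (\<exists>s\<in>A. fold (jtrans M) w s \<in> jfinal M)" if w: "w \<in> lists \<Sigma>" for w
  proof -
    have sub: "fold (jtrans M) w ` A \<subseteq> carrier (jsl M)"
      using fold_trans_closed[OF is_dfa_underlying[OF assms(1)] w] assms(2)
      by (auto simp: underlying_def)
    have finw: "finite (fold (jtrans M) w ` A)"
      using fin by simp
    \<comment> \<open>Being final includes being a state, so the join must be known to lie in the
      carrier before it is compared with \<open>t\<close>.\<close>
    have "\<Squnion>\<^bsub>jsl M\<^esub> (fold (jtrans M) w ` A) \<in> carrier (jsl M)"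
      using finite_sup_least_Upper[OF finw sub] by (rule least_closed)
    then have "fold (jtrans M) w (\<Squnion>\<^bsub>jsl M\<^esub> A) \<in> jfinal M \<longleftrightarrow>
        (\<exists>s\<in>A. \<not> fold (jtrans M) w s \<sqsubseteq>\<^bsub>jsl M\<^esub> t)"
      by (simp add: fold_jtrans_sup[OF assms(1) w fin assms(2)] final sup_le_iff[OF finw sub t])
    then show ?thesis
      using sub by (auto simp: final)
  qed
  then show ?thesis
    unfolding set_eq_iff UN_iff mem_state_language_iff
    by (simp add: underlying_def cong: conj_cong del: in_lists_conv_set)
qed

lemma card_LQ_le_card_states:
  assumes "is_jsl_dfa \<Sigma> M" "accepts \<Sigma> M L"
  shows "card (LQ \<Sigma> L) \<le> card (carrier (jsl M))"
proof (rule surj_card_le)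
  show "finite (carrier (jsl M))"
    using assms(1) by (simp add: is_jsl_dfa_def)
  interpret join_semilattice "jsl M"
    using assms(1) by (simp add: is_jsl_dfa_def)
  show "LQ \<Sigma> L \<subseteq> state_language \<Sigma> (underlying M) ` carrier (jsl M)"
  proof
    fix X assume "X \<in> LQ \<Sigma> L"
    then obtain U where U: "U \<subseteq> lists \<Sigma>" "X = left_quotient \<Sigma> U L"
      by (auto simp: LQ_def)
    \<comment> \<open>Even for infinite \<open>U\<close> this set of reached states is finite, so
      its join exists.\<close>
    let ?A = "(\<lambda>u. fold (trans (underlying M)) u (init (underlying M))) ` U"
    have A: "?A \<subseteq> carrier (jsl M)"
      using reached_subset_states[OF is_dfa_underlying[OF assms(1)] U(1)]
      by (simp add: underlying_def)
    have "X = (\<Union>s\<in>?A. state_language \<Sigma> (underlying M) s)"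
      using left_quotient_language[OF U(1), of "underlying M"] U(2) assms(2)
      by (simp add: accepts_def)
    \<comment> \<open>The join trades the set of states for a single state; this bounds the
      quotients by the number of states rather than of sets of states.\<close>
    also have "\<dots> = state_language \<Sigma> (underlying M) (\<Squnion>\<^bsub>jsl M\<^esub> ?A)"
      using state_language_sup[OF assms(1) A] by simp
    finally show "X \<in> state_language \<Sigma> (underlying M) ` carrier (jsl M)"
      using least_closed[OF finite_sup_least_Upper[OF finite_subset[OF A] A]]
        \<open>finite (carrier (jsl M))\<close> by (intro image_eqI) simp_all
  qed
qed

text \<open>\<open>LQ_jsl\<close> is given by its inclusion order alone; the first two conjuncts
  identify its derived join and bottom with union and the empty set.\<close>

theorem lemma3p3p3:
  fixes \<Sigma> :: "'a set" and L :: "'a list set"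
  assumes "L \<subseteq> lists \<Sigma>" and "regular \<Sigma> L"
  shows "(\<forall>X \<in> LQ \<Sigma> L. \<forall>Y \<in> LQ \<Sigma> L. X \<squnion>\<^bsub>LQ_jsl \<Sigma> L\<^esub> Y = X \<union> Y)
       \<and> \<bottom>\<^bsub>LQ_jsl \<Sigma> L\<^esub> = {}
       \<and> is_jsl_dfa \<Sigma> (canonical_dfa \<Sigma> L)
       \<and> accepts \<Sigma> (canonical_dfa \<Sigma> L) L
       \<and> (\<forall>M :: ('a, 's) jsl_automaton. is_jsl_dfa \<Sigma> M \<and> accepts \<Sigma> M L
            \<longrightarrow> card (LQ \<Sigma> L) \<le> card (carrier (jsl M)))"
proof (intro conjI ballI allI impI)
  show "X \<squnion>\<^bsub>LQ_jsl \<Sigma> L\<^esub> Y = X \<union> Y" if "X \<in> LQ \<Sigma> L" "Y \<in> LQ \<Sigma> L" for X Y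
    using that by (simp add: join_def sup_LQ_jsl)
  show "\<bottom>\<^bsub>LQ_jsl \<Sigma> L\<^esub> = {}"
    by (rule bottom_LQ_jsl)
  show "is_jsl_dfa \<Sigma> (canonical_dfa \<Sigma> L)"
    using assms by (rule is_jsl_dfa_canonical_dfa)
  show "accepts \<Sigma> (canonical_dfa \<Sigma> L) L"
    using assms(1) by (rule accepts_canonical_dfa)
  show "card (LQ \<Sigma> L) \<le> card (carrier (jsl M))"
    if "is_jsl_dfa \<Sigma> M \<and> accepts \<Sigma> M L" for M :: "('a, 's) jsl_automaton"
    using that card_LQ_le_card_states by blast
qed

end
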